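(* Let $(\mathscr{C},\mathbb{E},\mathfrak{s})$ be an extriangulated category such that $\mathscr{C}$ is small, and let $(\tilde{\mathscr{C}},\mathbb{F},\mathfrak{r})$ be its idempotent completion. Then the weak idempotent completion $\hat{\mathscr{C}}$ of $\mathscr{C}$ is an extension-closed subcategory of $\tilde{\mathscr{C}}$.
   Context: Extriangulated categories are in the sense of Nakaoka–Palu: $\mathscr{C}$ is additive, $\mathbb{E}\colon\mathscr{C}^{\mathrm{op}}\times\mathscr{C}\to Ab$ is a biadditive functor, and $\mathfrak{s}$ is an additive realisation assigning to each $\delta\in\mathbb{E}(C,A)$ an equivalence class $\mathfrak{s}(\delta)=[A\xrightarrow{x}B\xrightarrow{y}C]$, subject to axioms (ET1)–(ET4), (ET3)$^{\mathrm{op}}$, (ET4)$^{\mathrm{op}}$. Sequences $A\xrightarrow{x}B\xrightarrow{y}C$ and $A\xrightarrow{x'}B'\xrightarrow{y'}C$ are equivalent if there is an isomorphism $b\colon B\to B'$ with $bx=x'$, $y'b=y$. Write $a_*\delta=\mathbb{E}(C,a)(\delta)$ and $c^*\delta=\mathbb{E}(c,A)(\delta)$. **Idempotent completion.** $\tilde{\mathscr{C}}$ has objects the pairs $(A,p)$ with $A\in\mathscr{C}$, $p\colon A\to A$, $p^2=p$. A morphism $(A,p)\to(B,q)$ is a morphism $\sigma\colon A\to B$ of $\mathscr{C}$ with $\sigma p=q\sigma=\sigma$; composition is that of $\mathscr{C}$, $1_{(A,p)}=p$, and $(A,p)\oplus(B,q)=(A\oplus B,p\oplus q)$. **The structure $(\mathbb{F},\mathfrak{r})$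 on $\tilde{\mathscr{C}}$.** On objects, $\mathbb{F}((X,p),(Y,q))=\{p^*q_*\delta\mid\delta\in\mathbb{E}(X,Y)\}\subseteq\mathbb{E}(X,Y)$. For $\alpha\colon(X,p)\to(Y,q)$ and $\beta\colon(U,e)\to(V,f)$ in $\tilde{\mathscr{C}}$, the map $\mathbb{F}(\alpha,\beta)\colon\mathbb{F}((Y,q),(U,e))\to\mathbb{F}((X,p),(V,f))$ is $\varepsilon\mapsto\beta_*\alpha^*\varepsilon$. For $\delta\in\mathbb{F}((Z,p),(X,q))$ with $\mathfrak{s}(\delta)=[X\xrightarrow{x}Y\xrightarrow{y}Z]$, one sets $\mathfrak{r}(\delta)=[(X,q)\xrightarrow{xq}(Y,r)\xrightarrow{py}(Z,p)]$ (equivalence class in $\tilde{\mathscr{C}}$), where $r\colon Y\to Y$ is an idempotent with $rx=xq$ and $yr=py$; such $r$ exists and the class does not depend on the choices. The triple $(\tilde{\mathscr{C}},\mathbb{F},\mathfrak{r})$ is an extriangulated category. **Weak idempotent completion.** $\hat{\mathscr{C}}$ is the full subcategory of $\tilde{\mathscr{C}}$ on the objects $(A,p)$ such that the idempotent $p$ splits in $\mathscr{C}$, i.e. $p=cr$ for some $r\colon A\to X$ and $c\colon X\to A$ in $\mathscr{C}$ with $rc=1_X$. **Extension-closed.** A conflation in an extriangulated category $(\mathscr{M},\mathbb{G},\mathfrak{t})$ is a sequence $A\to B\to C$ representing $\mathfrak{t}(\delta)$ for some $\delta\in\mathbb{G}(C,A)$. A full additive subcategory $\mathscr{N}$ of $\mathscr{M}$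 closed under isomorphisms is extension-closed if for every conflation $A\to B\to C$ with $A,C\in\mathscr{N}$ one has $B\in\mathscr{N}$. (Being an extension-closed subcategory includes being full, additive and closed under isomorphisms.) *)

theory Defs
  imports "HOL-Algebra.Group"
begin

section \<open>Additive categories\<close>

text \<open>
  Abelian groups are \<^const>\<open>comm_group\<close>s, hence written multiplicatively:
  in \<open>Hom C A B\<close> and \<open>Ext C D A\<close> below, \<open>\<otimes>\<close> is addition and \<open>\<one>\<close> is zero.

  The sets \<open>carrier (Hom C A B)\<close> are not required to be pairwise disjoint, because in the
  idempotent completion one and the same \<open>\<sigma>\<close> is a morphism between several pairs of objects.
  Composition does not depend on the objects; this is no restriction, as a small category can be
  presented with disjoint hom-sets.
\<close>

record ('o, 'm) category_data =
  Obj :: "'o set"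
  Hom :: "'o \<Rightarrow> 'o \<Rightarrow> 'm monoid"
  Comp :: "'m \<Rightarrow> 'm \<Rightarrow> 'm"  (infixl "\<cdot>\<index>" 75)
  Id :: "'o \<Rightarrow> 'm"

abbreviation Mor :: "('o, 'm, 'x) category_data_scheme \<Rightarrow> 'o \<Rightarrow> 'o \<Rightarrow> 'm set" where
  "Mor C A B \<equiv> carrier (Hom C A B)"

abbreviation zero_mor :: "('o, 'm, 'x) category_data_scheme \<Rightarrow> 'o \<Rightarrow> 'o \<Rightarrow> 'm" where
  "zero_mor C A B \<equiv> \<one>\<^bsub>Hom C A B\<^esub>"

locale category =
  fixes C :: "('o, 'm, 'x) category_data_scheme" (structure)
  assumes comp_closed: "\<lbrakk>A \<in> Obj C; B \<in> Obj C; D \<in> Obj C; f \<in> Mor C A B; g \<in> Mor C B D\<rbrakk>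
      \<Longrightarrow> g \<cdot> f \<in> Mor C A D"
    and comp_assoc: "\<lbrakk>A \<in> Obj C; B \<in> Obj C; D \<in> Obj C; E \<in> Obj C;
        f \<in> Mor C A B; g \<in> Mor C B D; h \<in> Mor C D E\<rbrakk> \<Longrightarrow> h \<cdot> (g \<cdot> f) = (h \<cdot> g) \<cdot> f"
    and id_closed: "A \<in> Obj C \<Longrightarrow> Id C A \<in> Mor C A A"
    and id_right: "\<lbrakk>A \<in> Obj C; B \<in> Obj C; f \<in> Mor C A B\<rbrakk> \<Longrightarrow> f \<cdot> Id C A = f"
    and id_left: "\<lbrakk>A \<in> Obj C; B \<in> Obj C; f \<in> Mor C A B\<rbrakk> \<Longrightarrow> Id C B \<cdot> f = f"

locale preadditive_category = category +
  assumes hom_comm_group: "\<lbrakk>A \<in> Obj C; B \<in> Obj C\<rbrakk> \<Longrightarrow> comm_group (Hom C A B)"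
    and precomp_hom: "\<lbrakk>A \<in> Obj C; B \<in> Obj C; D \<in> Obj C; f \<in> Mor C A B\<rbrakk>
      \<Longrightarrow> (\<lambda>g. g \<cdot> f) \<in> hom (Hom C B D) (Hom C A D)"
    and postcomp_hom: "\<lbrakk>A \<in> Obj C; B \<in> Obj C; D \<in> Obj C; g \<in> Mor C B D\<rbrakk>
      \<Longrightarrow> (\<lambda>f. g \<cdot> f) \<in> hom (Hom C A B) (Hom C A D)"

definition zero_object :: "('o, 'm, 'x) category_data_scheme \<Rightarrow> 'o \<Rightarrow> bool" where
  "zero_object C Z \<longleftrightarrow> Z \<in> Obj C \<and>
     (\<forall>A \<in> Obj C. (\<exists>!f. f \<in> Mor C Z A) \<and> (\<exists>!f. f \<in> Mor C A Z))"

definition biproduct ::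
  "('o, 'm, 'x) category_data_scheme \<Rightarrow> 'o \<Rightarrow> 'o \<Rightarrow> 'o \<Rightarrow> 'm \<Rightarrow> 'm \<Rightarrow> 'm \<Rightarrow> 'm \<Rightarrow> bool" where
  "biproduct C A A' S i i' \<pi> \<pi>' \<longleftrightarrow>
     A \<in> Obj C \<and> A' \<in> Obj C \<and> S \<in> Obj C \<and>
     i \<in> Mor C A S \<and> i' \<in> Mor C A' S \<and> \<pi> \<in> Mor C S A \<and> \<pi>' \<in> Mor C S A' \<and>
     \<pi> \<cdot>\<^bsub>C\<^esub> i = Id C A \<and> \<pi>' \<cdot>\<^bsub>C\<^esub> i' = Id C A' \<and>
     \<pi> \<cdot>\<^bsub>C\<^esub> i' = zero_mor C A' A \<and> \<pi>' \<cdot>\<^bsub>C\<^esub> i = zero_mor C A A' \<and>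
     (i \<cdot>\<^bsub>C\<^esub> \<pi>) \<otimes>\<^bsub>Hom C S S\<^esub> (i' \<cdot>\<^bsub>C\<^esub> \<pi>') = Id C S"

locale additive_category = preadditive_category +
  assumes zero_object_exists: "\<exists>Z. zero_object C Z"
    and biproduct_exists: "\<lbrakk>A \<in> Obj C; A' \<in> Obj C\<rbrakk> \<Longrightarrow> \<exists>S i i' \<pi> \<pi>'. biproduct C A A' S i i' \<pi> \<pi>'"

definition isomorphism :: "('o, 'm, 'x) category_data_scheme \<Rightarrow> 'o \<Rightarrow> 'o \<Rightarrow> 'm \<Rightarrow> bool" where
  "isomorphism C A B f \<longleftrightarrow> f \<in> Mor C A B \<and>
     (\<exists>g \<in> Mor C B A. g \<cdot>\<^bsub>C\<^esub> f = Id C A \<and> f \<cdot>\<^bsub>C\<^esub> g = Id C B)"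


section \<open>Sequences and their equivalence\<close>

text \<open>The triple \<open>(x, B, y)\<close> stands for \<open>A \<rightarrow> B \<rightarrow> D\<close> with maps \<open>x\<close> and \<open>y\<close>; the end terms
  \<open>A\<close> and \<open>D\<close> are carried along as parameters.\<close>

definition sequences :: "('o, 'm, 'x) category_data_scheme \<Rightarrow> 'o \<Rightarrow> 'o \<Rightarrow> ('m \<times> 'o \<times> 'm) set" where
  "sequences C A D = {(x, B, y). B \<in> Obj C \<and> x \<in> Mor C A B \<and> y \<in> Mor C B D}"

definition seq_equiv ::
  "('o, 'm, 'x) category_data_scheme \<Rightarrow> 'o \<Rightarrow> 'o \<Rightarrow> ('m \<times> 'o \<times> 'm) rel" where
  "seq_equiv C A D = {((x, B, y), (x', B', y')).
     (x, B, y) \<in> sequences C A D \<and> (x', B', y') \<in> sequences C A D \<and>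
     (\<exists>b. isomorphism C B B' b \<and> b \<cdot>\<^bsub>C\<^esub> x = x' \<and> y' \<cdot>\<^bsub>C\<^esub> b = y)}"

definition seq_class ::
  "('o, 'm, 'x) category_data_scheme \<Rightarrow> 'o \<Rightarrow> 'o \<Rightarrow> 'm \<times> 'o \<times> 'm \<Rightarrow> ('m \<times> 'o \<times> 'm) set" where
  "seq_class C A D s = seq_equiv C A D `` {s}"


section \<open>Extriangulated categories\<close>

text \<open>
  \<open>Ext C D A\<close> is \<open>\<E>(D, A)\<close>. For \<open>c : D' \<rightarrow> D\<close> and \<open>a : A \<rightarrow> A'\<close>, \<open>ExtMap C c a\<close> is
  \<open>\<E>(c, a) : \<E>(D, A) \<rightarrow> \<E>(D', A')\<close>. For \<open>\<delta> \<in> \<E>(D, A)\<close>, \<open>Real C D A \<delta>\<close> is the equivalence class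
  \<open>\<s>(\<delta>)\<close> of sequences \<open>A \<rightarrow> B \<rightarrow> D\<close>.
\<close>

record ('o, 'm, 'e) extri_data = "('o, 'm) category_data" +
  Ext :: "'o \<Rightarrow> 'o \<Rightarrow> 'e monoid"
  ExtMap :: "'m \<Rightarrow> 'm \<Rightarrow> 'e \<Rightarrow> 'e"
  Real :: "'o \<Rightarrow> 'o \<Rightarrow> 'e \<Rightarrow> ('m \<times> 'o \<times> 'm) set"

text \<open>\<open>push C D a \<delta> = a\<^sub>* \<delta> = \<E>(D, a)(\<delta>)\<close> and \<open>pull C A c \<delta> = c\<^sup>* \<delta> = \<E>(c, A)(\<delta>)\<close>.\<close>

definition push :: "('o, 'm, 'e, 'x) extri_data_scheme \<Rightarrow> 'o \<Rightarrow> 'm \<Rightarrow> 'e \<Rightarrow> 'e" where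
  "push C D a \<delta> = ExtMap C (Id C D) a \<delta>"

definition pull :: "('o, 'm, 'e, 'x) extri_data_scheme \<Rightarrow> 'o \<Rightarrow> 'm \<Rightarrow> 'e \<Rightarrow> 'e" where
  "pull C A c \<delta> = ExtMap C c (Id C A) \<delta>"

text \<open>Axiom (ET1).\<close>

locale biadditive_ext = additive_category C
  for C :: "('o, 'm, 'e, 'x) extri_data_scheme" (structure) +
  assumes ext_comm_group: "\<lbrakk>D \<in> Obj C; A \<in> Obj C\<rbrakk> \<Longrightarrow> comm_group (Ext C D A)"
    and ext_map_hom: "\<lbrakk>D \<in> Obj C; D' \<in> Obj C; A \<in> Obj C; A' \<in> Obj C; c \<in> Mor C D' D; a \<in> Mor C A A'\<rbrakk>
      \<Longrightarrow> ExtMap C c a \<in> hom (Ext C D A) (Ext C D' A')"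
    and ext_map_id: "\<lbrakk>D \<in> Obj C; A \<in> Obj C; \<delta> \<in> carrier (Ext C D A)\<rbrakk>
      \<Longrightarrow> ExtMap C (Id C D) (Id C A) \<delta> = \<delta>"
    and ext_map_comp: "\<lbrakk>D \<in> Obj C; D' \<in> Obj C; D'' \<in> Obj C; A \<in> Obj C; A' \<in> Obj C; A'' \<in> Obj C;
        c \<in> Mor C D' D; c' \<in> Mor C D'' D'; a \<in> Mor C A A'; a' \<in> Mor C A' A'';
        \<delta> \<in> carrier (Ext C D A)\<rbrakk>
      \<Longrightarrow> ExtMap C (c \<cdot> c') (a' \<cdot> a) \<delta> = ExtMap C c' a' (ExtMap C c a \<delta>)"
    and push_add: "\<lbrakk>D \<in> Obj C; A \<in> Obj C; A' \<in> Obj C; a \<in> Mor C A A'; b \<in> Mor C A A';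
        \<delta> \<in> carrier (Ext C D A)\<rbrakk>
      \<Longrightarrow> push C D (a \<otimes>\<^bsub>Hom C A A'\<^esub> b) \<delta> = push C D a \<delta> \<otimes>\<^bsub>Ext C D A'\<^esub> push C D b \<delta>"
    and pull_add: "\<lbrakk>D \<in> Obj C; D' \<in> Obj C; A \<in> Obj C; c \<in> Mor C D' D; d \<in> Mor C D' D;
        \<delta> \<in> carrier (Ext C D A)\<rbrakk>
      \<Longrightarrow> pull C A (c \<otimes>\<^bsub>Hom C D' D\<^esub> d) \<delta> = pull C A c \<delta> \<otimes>\<^bsub>Ext C D' A\<^esub> pull C A d \<delta>"

text \<open>
  Given \<open>\<delta> \<in> \<E>(D, A)\<close>, \<open>\<delta>' \<in> \<E>(D', A')\<close> and biproducts \<open>SD\<close> of \<open>D, D'\<close> (injections \<open>j, j'\<close>) and \<open>SA\<close>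
  of \<open>A, A'\<close> (projections \<open>\<pi>, \<pi>'\<close>), \<open>\<epsilon> = \<delta> \<oplus> \<delta>'\<close> is the element of \<open>\<E>(SD, SA)\<close> corresponding to
  \<open>(\<delta>, 0, 0, \<delta>')\<close> in \<open>\<E>(D, A) \<oplus> \<E>(D, A') \<oplus> \<E>(D', A) \<oplus> \<E>(D', A')\<close>.
\<close>

definition is_ext_sum ::
  "('o, 'm, 'e, 'x) extri_data_scheme \<Rightarrow> 'o \<Rightarrow> 'o \<Rightarrow> 'o \<Rightarrow> 'o \<Rightarrow> 'o \<Rightarrow> 'o \<Rightarrow>
     'm \<Rightarrow> 'm \<Rightarrow> 'm \<Rightarrow> 'm \<Rightarrow> 'e \<Rightarrow> 'e \<Rightarrow> 'e \<Rightarrow> bool" where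
  "is_ext_sum C D D' SD A A' SA j j' \<pi> \<pi>' \<delta> \<delta>' \<epsilon> \<longleftrightarrow>
     \<epsilon> \<in> carrier (Ext C SD SA) \<and>
     ExtMap C j \<pi> \<epsilon> = \<delta> \<and> ExtMap C j \<pi>' \<epsilon> = \<one>\<^bsub>Ext C D A'\<^esub> \<and>
     ExtMap C j' \<pi> \<epsilon> = \<one>\<^bsub>Ext C D' A\<^esub> \<and> ExtMap C j' \<pi>' \<epsilon> = \<delta>'"

text \<open>Axiom (ET2). In \<open>real_sum\<close>, the two maps in the class on the right are \<open>x \<oplus> x'\<close> and \<open>y \<oplus> y'\<close>.\<close>

locale additive_realisation = biadditive_ext +
  assumes real_class: "\<lbrakk>D \<in> Obj C; A \<in> Obj C; \<delta> \<in> carrier (Ext C D A)\<rbrakk>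
      \<Longrightarrow> Real C D A \<delta> \<in> sequences C A D // seq_equiv C A D"
    and real_morphism: "\<lbrakk>A \<in> Obj C; D \<in> Obj C; A' \<in> Obj C; D' \<in> Obj C;
        \<delta> \<in> carrier (Ext C D A); \<delta>' \<in> carrier (Ext C D' A');
        (x, B, y) \<in> Real C D A \<delta>; (x', B', y') \<in> Real C D' A' \<delta>';
        a \<in> Mor C A A'; c \<in> Mor C D D'; push C D a \<delta> = pull C A' c \<delta>'\<rbrakk>
      \<Longrightarrow> \<exists>b \<in> Mor C B B'. b \<cdot> x = x' \<cdot> a \<and> y' \<cdot> b = c \<cdot> y"
    and real_zero: "biproduct C A D S i i' \<pi> \<pi>'
      \<Longrightarrow> Real C D A \<one>\<^bsub>Ext C D A\<^esub> = seq_class C A D (i, S, \<pi>')"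
    and real_sum: "\<lbrakk>\<delta> \<in> carrier (Ext C D A); \<delta>' \<in> carrier (Ext C D' A');
        (x, B, y) \<in> Real C D A \<delta>; (x', B', y') \<in> Real C D' A' \<delta>';
        biproduct C A A' SA iA iA' \<pi>A \<pi>A';
        biproduct C B B' SB iB iB' \<pi>B \<pi>B';
        biproduct C D D' SD iD iD' \<pi>D \<pi>D';
        is_ext_sum C D D' SD A A' SA iD iD' \<pi>A \<pi>A' \<delta> \<delta>' \<epsilon>\<rbrakk>
      \<Longrightarrow> Real C SD SA \<epsilon> = seq_class C SA SD
            ((iB \<cdot> x \<cdot> \<pi>A) \<otimes>\<^bsub>Hom C SA SB\<^esub> (iB' \<cdot> x' \<cdot> \<pi>A'), SB,
             (iD \<cdot> y \<cdot> \<pi>B) \<otimes>\<^bsub>Hom C SB SD\<^esub> (iD' \<cdot> y' \<cdot> \<pi>B'))"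

locale extriangulated_category = additive_realisation +
  assumes ET3: "\<lbrakk>A \<in> Obj C; D \<in> Obj C; A' \<in> Obj C; D' \<in> Obj C;
        \<delta> \<in> carrier (Ext C D A); \<delta>' \<in> carrier (Ext C D' A');
        (x, B, y) \<in> Real C D A \<delta>; (x', B', y') \<in> Real C D' A' \<delta>';
        a \<in> Mor C A A'; b \<in> Mor C B B'; b \<cdot> x = x' \<cdot> a\<rbrakk>
      \<Longrightarrow> \<exists>c \<in> Mor C D D'. c \<cdot> y = y' \<cdot> b \<and> push C D a \<delta> = pull C A' c \<delta>'"
    and ET3op: "\<lbrakk>A \<in> Obj C; D \<in> Obj C; A' \<in> Obj C; D' \<in> Obj C;
        \<delta> \<in> carrier (Ext C D A); \<delta>' \<in> carrier (Ext C D' A');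
        (x, B, y) \<in> Real C D A \<delta>; (x', B', y') \<in> Real C D' A' \<delta>';
        b \<in> Mor C B B'; c \<in> Mor C D D'; c \<cdot> y = y' \<cdot> b\<rbrakk>
      \<Longrightarrow> \<exists>a \<in> Mor C A A'. b \<cdot> x = x' \<cdot> a \<and> push C D a \<delta> = pull C A' c \<delta>'"
    and ET4: "\<lbrakk>A \<in> Obj C; B \<in> Obj C; D \<in> Obj C; F \<in> Obj C;
        \<delta> \<in> carrier (Ext C D A); \<delta>' \<in> carrier (Ext C F B);
        (f, B, f') \<in> Real C D A \<delta>; (g, G, g') \<in> Real C F B \<delta>'\<rbrakk>
      \<Longrightarrow> \<exists>E \<in> Obj C. \<exists>d \<in> Mor C D E. \<exists>e \<in> Mor C E F. \<exists>h \<in> Mor C A G. \<exists>h' \<in> Mor C G E.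
            \<exists>\<delta>'' \<in> carrier (Ext C E A).
              h = g \<cdot> f \<and> h' \<cdot> g = d \<cdot> f' \<and> e \<cdot> h' = g' \<and>
              (h, G, h') \<in> Real C E A \<delta>'' \<and>
              (d, E, e) \<in> Real C F D (push C F f' \<delta>') \<and>
              pull C A d \<delta>'' = \<delta> \<and>
              push C E f \<delta>'' = pull C B e \<delta>'"
    and ET4op: "\<lbrakk>D \<in> Obj C; B \<in> Obj C; F \<in> Obj C; G \<in> Obj C;
        \<delta> \<in> carrier (Ext C B D); \<delta>' \<in> carrier (Ext C G F);
        (f', A, f) \<in> Real C B D \<delta>; (g', B, g) \<in> Real C G F \<delta>'\<rbrakk>
      \<Longrightarrow> \<exists>E \<in> Obj C. \<exists>d \<in> Mor C D E. \<exists>e \<in> Mor C E F. \<exists>h' \<in> Mor C E A. \<exists>h \<in> Mor C A G.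
            \<exists>\<delta>'' \<in> carrier (Ext C G E).
              h = g \<cdot> f \<and> f \<cdot> h' = g' \<cdot> e \<and> h' \<cdot> d = f' \<and>
              (h', A, h) \<in> Real C G E \<delta>'' \<and>
              (d, E, e) \<in> Real C F D (pull C D g' \<delta>) \<and>
              push C G e \<delta>'' = \<delta>' \<and>
              push C B d \<delta> = pull C E g \<delta>''"


section \<open>Idempotent completion\<close>

definition karoubi :: "('o, 'm, 'x) category_data_scheme \<Rightarrow> ('o \<times> 'm, 'm) category_data" where
  "karoubi C = \<lparr>
     Obj = {(A, p). A \<in> Obj C \<and> p \<in> Mor C A A \<and> p \<cdot>\<^bsub>C\<^esub> p = p},
     Hom = (\<lambda>(A, p) (B, q).
       (Hom C A B)\<lparr>carrier := {\<sigma> \<in> Mor C A B. \<sigma> \<cdot>\<^bsub>C\<^esub> p = \<sigma> \<and> q \<cdot>\<^bsub>C\<^esub> \<sigma> = \<sigma>}\<rparr>),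
     Comp = Comp C,
     Id = snd\<rparr>"

text \<open>
  \<open>\<F>(\<alpha>, \<beta>)(\<epsilon>) = \<beta>\<^sub>* \<alpha>\<^sup>* \<epsilon>\<close> is \<open>\<E>(\<alpha>, \<beta>)(\<epsilon>)\<close>, so \<^const>\<open>ExtMap\<close> is inherited.

  \<open>\<r>(\<delta>)\<close> is the class of \<open>(X, q) \<rightarrow> (Y, r) \<rightarrow> (Z, p)\<close> with maps \<open>x q\<close> and \<open>p y\<close>, where \<open>(x, Y, y)\<close> is
  any representative of \<open>\<s>(\<delta>)\<close> and \<open>r\<close> any idempotent with \<open>r x = x q\<close> and \<open>y r = p y\<close>. As all
  choices give the same class, that class is written as the union over the choices.
\<close>

definition idempotent_completion :: "('o, 'm, 'e) extri_data \<Rightarrow> ('o \<times> 'm, 'm, 'e) extri_data" where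
  "idempotent_completion C = \<lparr>
     Obj = Obj (karoubi C),
     Hom = Hom (karoubi C),
     Comp = Comp (karoubi C),
     Id = Id (karoubi C),
     Ext = (\<lambda>(X, p) (Y, q).
       (Ext C X Y)\<lparr>carrier := {pull C Y p (push C X q \<delta>) | \<delta>. \<delta> \<in> carrier (Ext C X Y)}\<rparr>),
     ExtMap = ExtMap C,
     Real = (\<lambda>(Z, p) (X, q) \<delta>.
       \<Union> {seq_class (karoubi C) (X, q) (Z, p) (x \<cdot>\<^bsub>C\<^esub> q, (Y, r), p \<cdot>\<^bsub>C\<^esub> y) | x Y y r.
            (x, Y, y) \<in> Real C Z X \<delta> \<and> r \<in> Mor C Y Y \<and> r \<cdot>\<^bsub>C\<^esub> r = r \<and>
            r \<cdot>\<^bsub>C\<^esub> x = x \<cdot>\<^bsub>C\<^esub> q \<and> y \<cdot>\<^bsub>C\<^esub> r = p \<cdot>\<^bsub>C\<^esub> y})\<rparr>"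

definition splits :: "('o, 'm, 'x) category_data_scheme \<Rightarrow> 'o \<Rightarrow> 'm \<Rightarrow> bool" where
  "splits C A p \<longleftrightarrow>
     (\<exists>X \<in> Obj C. \<exists>r \<in> Mor C A X. \<exists>c \<in> Mor C X A. p = c \<cdot>\<^bsub>C\<^esub> r \<and> r \<cdot>\<^bsub>C\<^esub> c = Id C X)"

definition weak_idempotent_completion ::
  "('o, 'm, 'x) category_data_scheme \<Rightarrow> ('o \<times> 'm, 'm) category_data" where
  "weak_idempotent_completion C =
     (karoubi C)\<lparr>Obj := {(A, p). (A, p) \<in> Obj (karoubi C) \<and> splits C A p}\<rparr>"


section \<open>Extension-closed subcategories\<close>

definition full_subcategory ::
  "('o, 'm, 'x) category_data_scheme \<Rightarrow> ('o, 'm, 'y) category_data_scheme \<Rightarrow> bool" where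
  "full_subcategory N M \<longleftrightarrow> Obj N \<subseteq> Obj M \<and>
     (\<forall>A \<in> Obj N. Id N A = Id M A) \<and>
     (\<forall>A \<in> Obj N. \<forall>B \<in> Obj N. Hom N A B = Hom M A B) \<and>
     (\<forall>A \<in> Obj N. \<forall>B \<in> Obj N. \<forall>D \<in> Obj N. \<forall>f \<in> Mor N A B. \<forall>g \<in> Mor N B D.
        g \<cdot>\<^bsub>N\<^esub> f = g \<cdot>\<^bsub>M\<^esub> f)"

definition conflation ::
  "('o, 'm, 'e, 'x) extri_data_scheme \<Rightarrow> 'o \<Rightarrow> 'm \<Rightarrow> 'o \<Rightarrow> 'm \<Rightarrow> 'o \<Rightarrow> bool" where
  "conflation M A x B y D \<longleftrightarrow> A \<in> Obj M \<and> D \<in> Obj M \<and>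
     (\<exists>\<delta> \<in> carrier (Ext M D A). (x, B, y) \<in> Real M D A \<delta>)"

text \<open>A full subcategory of an additive category that is itself additive has the same zero objects
  and biproducts as the ambient category.\<close>

definition extension_closed_subcategory ::
  "('o, 'm, 'x) category_data_scheme \<Rightarrow> ('o, 'm, 'e, 'y) extri_data_scheme \<Rightarrow> bool" where
  "extension_closed_subcategory N M \<longleftrightarrow>
     full_subcategory N M \<and> additive_category N \<and>
     (\<forall>A \<in> Obj N. \<forall>B \<in> Obj M. (\<exists>f. isomorphism M A B f) \<longrightarrow> B \<in> Obj N) \<and>
     (\<forall>A x B y D. conflation M A x B y D \<and> A \<in> Obj N \<and> D \<in> Obj N \<longrightarrow> B \<in> Obj N)"

end

theory Submission
  imports Defs
begin

text \<open>
  An object \<open>(A, p)\<close> whose idempotent splits through \<open>X\<close> is isomorphic to \<open>(X, 1)\<close>, which yields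
  biproducts. For extension-closedness, let \<open>\<delta> \<in> \<F>((Z, p), (X, q))\<close> be realised by
  \<open>(X, q) \<rightarrow> (Y, r) \<rightarrow> (Z, p)\<close>, with \<open>q = c a\<close> and \<open>p = d b\<close> split through \<open>X'\<close> and \<open>Z'\<close>. Realise
  \<open>\<E>(d, a)(\<delta>)\<close> in \<open>\<C>\<close> by \<open>X' \<rightarrow> E \<rightarrow> Z'\<close>. The pairs \<open>(c, d)\<close> and \<open>(a, b)\<close> are morphisms of extensions
  and so lift to maps between \<open>E\<close> and \<open>(Y, r)\<close>. Both composites differ from the
  identity by a map vanishing on the inflation and killed by the deflation; by (ET3) such a map
  factors through the deflation and hence squares to zero. So \<open>(Y, r)\<close> is isomorphic to \<open>(E, 1)\<close>.
\<close>

section \<open>Preadditive categories\<close>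

context preadditive_category
begin

lemma zero_closed: "\<lbrakk>A \<in> Obj C; B \<in> Obj C\<rbrakk> \<Longrightarrow> zero_mor C A B \<in> Mor C A B"
  using hom_comm_group by (meson comm_group.axioms(2) group.subgroup_self subgroup.one_closed)

lemma comp_add_left:
  "\<lbrakk>A \<in> Obj C; B \<in> Obj C; D \<in> Obj C; f \<in> Mor C A B; g \<in> Mor C B D; h \<in> Mor C B D\<rbrakk>
    \<Longrightarrow> (g \<otimes>\<^bsub>Hom C B D\<^esub> h) \<cdot> f = (g \<cdot> f) \<otimes>\<^bsub>Hom C A D\<^esub> (h \<cdot> f)"
  using precomp_hom[of A B D f] by (simp add: hom_def)

lemma comp_add_right:
  "\<lbrakk>A \<in> Obj C; B \<in> Obj C; D \<in> Obj C; f \<in> Mor C A B; h \<in> Mor C A B; g \<in> Mor C B D\<rbrakk>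
    \<Longrightarrow> g \<cdot> (f \<otimes>\<^bsub>Hom C A B\<^esub> h) = (g \<cdot> f) \<otimes>\<^bsub>Hom C A D\<^esub> (g \<cdot> h)"
  using postcomp_hom[of A B D g] by (simp add: hom_def)

lemma zero_comp:
  assumes "A \<in> Obj C" "B \<in> Obj C" "D \<in> Obj C" "f \<in> Mor C A B"
  shows "zero_mor C B D \<cdot> f = zero_mor C A D"
  using group_hom.hom_one[of "Hom C B D" "Hom C A D" "\<lambda>g. g \<cdot> f"] precomp_hom[OF assms]
    hom_comm_group[OF assms(2,3)] hom_comm_group[OF assms(1,3)]
  by (simp add: group_hom_def group_hom_axioms_def comm_group_def)

lemma comp_zero:
  assumes "A \<in> Obj C" "B \<in> Obj C" "D \<in> Obj C" "g \<in> Mor C B D"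
  shows "g \<cdot> zero_mor C A B = zero_mor C A D"
  using group_hom.hom_one[of "Hom C A B" "Hom C A D" "\<lambda>f. g \<cdot> f"] postcomp_hom[OF assms]
    hom_comm_group[OF assms(1,2)] hom_comm_group[OF assms(1,3)]
  by (simp add: group_hom_def group_hom_axioms_def comm_group_def)

lemma add_eq_self:
  assumes "A \<in> Obj C" "B \<in> Obj C" "f \<in> Mor C A B" "g \<in> Mor C A B" "f \<otimes>\<^bsub>Hom C A B\<^esub> g = f"
  shows "g = zero_mor C A B"
proof -
  interpret comm_group "Hom C A B" using hom_comm_group assms by blast
  show ?thesis using assms by simp
qed

end

lemma comm_group_subgroup:
  assumes "comm_group G" "subgroup H G"
  shows "comm_group (G\<lparr>carrier := H\<rparr>)"
proof -
  interpret comm_group G by fact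
  show ?thesis
    using subgroup.subgroup_is_group[OF assms(2) is_group] subgroup.subset[OF assms(2)]
    by (intro group.group_comm_groupI) (auto intro: m_comm)
qed

text \<open>Supplies a biproduct to which \<open>real_zero\<close> applies: the zero extension in
  \<open>Ext C B Z\<close> is then realised by the sequence with maps 0 and
  \<open>Id C B\<close>.\<close>

lemma biproduct_zero_left:
  assumes "preadditive_category C" and Z: "zero_object C Z" and B: "B \<in> Obj C"
  shows "biproduct C Z B B (zero_mor C Z B) (Id C B) (zero_mor C B Z) (Id C B)"
proof -
  interpret preadditive_category C by fact
  have ZO: "Z \<in> Obj C" using Z unfolding zero_object_def by blast
  then have uniq: "\<And>f g. f \<in> Mor C Z Z \<Longrightarrow> g \<in> Mor C Z Z \<Longrightarrow> f = g"
    using Z unfolding zero_object_def by blast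
  interpret BB: comm_group "Hom C B B" using hom_comm_group B by blast
  note cl = B ZO zero_closed[OF B ZO] zero_closed[OF ZO B] zero_closed[OF ZO ZO]
    id_closed[OF B] id_closed[OF ZO]
  show ?thesis
    unfolding biproduct_def
    using cl zero_comp[of Z B Z "zero_mor C Z B"] zero_comp[of B Z B "zero_mor C B Z"]
      uniq[OF zero_closed[OF ZO ZO] id_closed[OF ZO]] id_left id_right
    by simp
qed


section \<open>The Karoubi envelope\<close>

lemma karoubi_simps [simp]:
  "Obj (karoubi C) = {(A, p). A \<in> Obj C \<and> p \<in> Mor C A A \<and> p \<cdot>\<^bsub>C\<^esub> p = p}"
  "Comp (karoubi C) = Comp C" "Id (karoubi C) = snd"
  "Hom (karoubi C) (A, p) (B, q) =
    (Hom C A B)\<lparr>carrier := {\<sigma> \<in> Mor C A B. \<sigma> \<cdot>\<^bsub>C\<^esub> p = \<sigma> \<and> q \<cdot>\<^bsub>C\<^esub> \<sigma> = \<sigma>}\<rparr>"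
  by (simp_all add: karoubi_def)

section \<open>Hom-groups and composition in the Karoubi envelope\<close>

context preadditive_category
begin

text \<open>The set consists of the common fixed points of two endomorphisms of the group
  \<open>Hom C A B\<close>, composition with \<open>p\<close> and composition with \<open>q\<close>;
  biadditivity makes both of them homomorphisms.\<close>

lemma karoubi_subgroup:
  assumes "(A, p) \<in> Obj (karoubi C)" "(B, q) \<in> Obj (karoubi C)"
  shows "subgroup {\<sigma> \<in> Mor C A B. \<sigma> \<cdot> p = \<sigma> \<and> q \<cdot> \<sigma> = \<sigma>} (Hom C A B)"
proof -
  have o: "A \<in> Obj C" "p \<in> Mor C A A" "p \<cdot> p = p" "B \<in> Obj C" "q \<in> Mor C B B" "q \<cdot> q = q"
    using assms by auto
  interpret G: comm_group "Hom C A B" using hom_comm_group o by blast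
  have p: "group_hom (Hom C A B) (Hom C A B) (\<lambda>g. g \<cdot> p)"
    and q: "group_hom (Hom C A B) (Hom C A B) (\<lambda>f. q \<cdot> f)"
    using precomp_hom[of A A B p] postcomp_hom[of A B B q] o G.is_group
    by (auto simp: group_hom_def group_hom_axioms_def)
  show ?thesis
    by (rule G.subgroupI)
      (use group_hom.hom_inv[OF p] group_hom.hom_inv[OF q] group_hom.hom_mult[OF p]
        group_hom.hom_mult[OF q] group_hom.hom_one[OF p] group_hom.hom_one[OF q] in auto)
qed

lemma comp_absorb_right:
  "\<lbrakk>f \<cdot> p = f; A \<in> Obj C; B \<in> Obj C; D \<in> Obj C; p \<in> Mor C A A; f \<in> Mor C A B; g \<in> Mor C B D\<rbrakk>
    \<Longrightarrow> (g \<cdot> f) \<cdot> p = g \<cdot> f"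
  using comp_assoc[of A A B D p f g] by metis

lemma comp_absorb_left:
  "\<lbrakk>p \<cdot> g = g; A \<in> Obj C; B \<in> Obj C; D \<in> Obj C; p \<in> Mor C D D; f \<in> Mor C A B; g \<in> Mor C B D\<rbrakk>
    \<Longrightarrow> p \<cdot> (g \<cdot> f) = g \<cdot> f"
  using comp_assoc[of A B D D f g p] by metis

lemma karoubi_comp_closed:
  assumes "A \<in> Obj (karoubi C)" "B \<in> Obj (karoubi C)" "D \<in> Obj (karoubi C)"
    and "f \<in> Mor (karoubi C) A B" "g \<in> Mor (karoubi C) B D"
  shows "g \<cdot> f \<in> Mor (karoubi C) A D"
  using assms comp_closed[of "fst A" "fst B" "fst D" f g]
    comp_absorb_right[of f "snd A" "fst A" "fst B" "fst D" g]
    comp_absorb_left[of "snd D" g "fst A" "fst B" "fst D" f]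
  by (cases A; cases B; cases D) simp

lemma preadditive_category_karoubi: "preadditive_category (karoubi C)"
proof (intro preadditive_category.intro category.intro preadditive_category_axioms.intro)
  fix A B D f g
  assume "A \<in> Obj (karoubi C)" "B \<in> Obj (karoubi C)" "D \<in> Obj (karoubi C)"
    "f \<in> Mor (karoubi C) A B" "g \<in> Mor (karoubi C) B D"
  then show "g \<cdot>\<^bsub>karoubi C\<^esub> f \<in> Mor (karoubi C) A D"
    using karoubi_comp_closed by simp
next
  fix A B D E f g h
  assume "A \<in> Obj (karoubi C)" "B \<in> Obj (karoubi C)" "D \<in> Obj (karoubi C)" "E \<in> Obj (karoubi C)"
    and "f \<in> Mor (karoubi C) A B" "g \<in> Mor (karoubi C) B D" "h \<in> Mor (karoubi C) D E"
  then show "h \<cdot>\<^bsub>karoubi C\<^esub> (g \<cdot>\<^bsub>karoubi C\<^esub> f) = (h \<cdot>\<^bsub>karoubi C\<^esub> g) \<cdot>\<^bsub>karoubi C\<^esub> f"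
    by (cases A; cases B; cases D; cases E) (simp; rule comp_assoc; blast)
next
  fix A assume "A \<in> Obj (karoubi C)"
  then show "Id (karoubi C) A \<in> Mor (karoubi C) A A" by (cases A) auto
next
  fix A B f assume "A \<in> Obj (karoubi C)" "B \<in> Obj (karoubi C)" "f \<in> Mor (karoubi C) A B"
  then show "f \<cdot>\<^bsub>karoubi C\<^esub> Id (karoubi C) A = f" "Id (karoubi C) B \<cdot>\<^bsub>karoubi C\<^esub> f = f"
    by (cases A; cases B; auto)+
next
  fix A B assume "A \<in> Obj (karoubi C)" "B \<in> Obj (karoubi C)"
  then show "comm_group (Hom (karoubi C) A B)"
    using comm_group_subgroup[OF hom_comm_group karoubi_subgroup]
    by (cases A; cases B) auto
next
  fix A B D f assume h: "A \<in> Obj (karoubi C)" "B \<in> Obj (karoubi C)" "D \<in> Obj (karoubi C)"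
    "f \<in> Mor (karoubi C) A B"
  show "(\<lambda>g. g \<cdot>\<^bsub>karoubi C\<^esub> f) \<in> hom (Hom (karoubi C) B D) (Hom (karoubi C) A D)"
    using h karoubi_comp_closed[OF h]
    by (cases A; cases B; cases D) (simp add: hom_def comp_add_left Pi_def)
next
  fix A B D g assume h: "A \<in> Obj (karoubi C)" "B \<in> Obj (karoubi C)" "D \<in> Obj (karoubi C)"
    "g \<in> Mor (karoubi C) B D"
  show "(\<lambda>f. g \<cdot>\<^bsub>karoubi C\<^esub> f) \<in> hom (Hom (karoubi C) A B) (Hom (karoubi C) A D)"
    using h karoubi_comp_closed[OF h(1-3) _ h(4)]
    by (cases A; cases B; cases D) (simp add: hom_def comp_add_right Pi_def)
qed

end

section \<open>Full subcategories and transport of splittings\<close>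

lemma preadditive_category_subset:
  assumes "preadditive_category M" "S \<subseteq> Obj M"
  shows "preadditive_category (M\<lparr>Obj := S\<rparr>)"
proof -
  interpret preadditive_category M by fact
  show ?thesis
  proof (intro preadditive_category.intro category.intro preadditive_category_axioms.intro,
      goal_cases)
    case (1 A B D f g)
    then show ?case using comp_closed[of A B D f g] assms(2) by auto
  next
    case (2 A B D E f g h)
    then show ?case using comp_assoc[of A B D E f g h] assms(2) by auto
  next
    case (4 A B f)
    then show ?case using id_right[of A B f] assms(2) by auto
  next
    case (5 A B f)
    then show ?case using id_left[of A B f] assms(2) by auto
  next
    case (6 A B)
    then show ?case using hom_comm_group[of A B] assms(2) by auto
  next
    case (7 A B D f)
    then show ?case using precomp_hom[of A B D f] assms(2) by auto
  next
    case (8 A B D g)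
    then show ?case using postcomp_hom[of A B D g] assms(2) by auto
  qed (use assms(2) id_closed in auto)
qed

text \<open>If \<open>p = c \<cdot> a\<close> splits and \<open>f\<close>, \<open>g\<close> are
  mutually inverse, then \<open>f \<cdot> c\<close> and \<open>a \<cdot> g\<close> split
  \<open>q\<close>: one composite is \<open>f \<cdot> p \<cdot> g = f \<cdot> g = q\<close>, the
  other \<open>a \<cdot> p \<cdot> c\<close>, which collapses to the identity of \<open>X\<close>.
  This gives closure under isomorphisms, and it carries a splitting from one representative of a
  realisation to another.\<close>

lemma (in category) splits_of_isomorphism:
  assumes "(A, p) \<in> Obj (karoubi C)" "(B, q) \<in> Obj (karoubi C)"
    and "isomorphism (karoubi C) (A, p) (B, q) f" "splits C A p"
  shows "splits C B q"
proof -
  have o: "A \<in> Obj C" "B \<in> Obj C" using assms by auto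
  obtain X a c where X: "X \<in> Obj C" "a \<in> Mor C A X" "c \<in> Mor C X A" "p = c \<cdot> a" "a \<cdot> c = Id C X"
    using assms unfolding splits_def by blast
  obtain g where f: "f \<in> Mor C A B" "f \<cdot> p = f" and g: "g \<in> Mor C B A" "g \<cdot> f = p" "f \<cdot> g = q"
    using assms(3) unfolding isomorphism_def by auto
  have fc: "f \<cdot> c \<in> Mor C X B" and ag: "a \<cdot> g \<in> Mor C B X" using comp_closed o X f g by blast+
  have "(f \<cdot> c) \<cdot> (a \<cdot> g) = f \<cdot> (c \<cdot> (a \<cdot> g))" using comp_assoc[OF _ _ _ _ ag X(3) f(1)] o X by simp
  also have "\<dots> = f \<cdot> (p \<cdot> g)" using comp_assoc[OF _ _ _ _ g(1) X(2) X(3)] o X by simp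
  also have "\<dots> = (f \<cdot> p) \<cdot> g" using comp_assoc[of B A A B g p f] o f g assms by simp
  finally have 1: "q = (f \<cdot> c) \<cdot> (a \<cdot> g)" using f g by simp
  have "(a \<cdot> g) \<cdot> (f \<cdot> c) = a \<cdot> (g \<cdot> (f \<cdot> c))" using comp_assoc[OF _ _ _ _ fc g(1) X(2)] o X by simp
  also have "\<dots> = a \<cdot> (p \<cdot> c)" using comp_assoc[OF _ _ _ _ X(3) f(1) g(1)] o X g by simp
  also have "\<dots> = a \<cdot> (c \<cdot> (a \<cdot> c))" using comp_assoc[OF _ _ _ _ X(3) X(2) X(3)] o X by simp
  also have "\<dots> = Id C X" using id_right[OF X(1) o(1) X(3)] X by simp
  finally show ?thesis unfolding splits_def using 1 X fc ag by blast
qed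


section \<open>The weak idempotent completion is additive\<close>

lemma weak_idempotent_completion_simps [simp]:
  "Obj (weak_idempotent_completion C) = {(A, p). (A, p) \<in> Obj (karoubi C) \<and> splits C A p}"
  "Hom (weak_idempotent_completion C) = Hom (karoubi C)"
  "Comp (weak_idempotent_completion C) = Comp C"
  "Id (weak_idempotent_completion C) = snd"
  by (auto simp: weak_idempotent_completion_def karoubi_def)

context additive_category
begin

lemma splits_Id: "X \<in> Obj C \<Longrightarrow> splits C X (Id C X)"
  unfolding splits_def using id_closed id_left by force

lemma Id_mem_weak: "X \<in> Obj C \<Longrightarrow> (X, Id C X) \<in> Obj (weak_idempotent_completion C)"
  using splits_Id id_closed id_left by auto

text \<open>Uniqueness passes down because the hom-sets are subsets of those of \<open>C\<close>;
  existence holds because a zero morphism stays zero under composition with idempotents.\<close>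

lemma zero_object_weak:
  assumes "zero_object C Z"
  shows "zero_object (weak_idempotent_completion C) (Z, Id C Z)"
proof -
  have Z: "Z \<in> Obj C" using assms unfolding zero_object_def by blast
  have "(\<exists>!f. f \<in> Mor (weak_idempotent_completion C) (Z, Id C Z) (A, p)) \<and>
        (\<exists>!f. f \<in> Mor (weak_idempotent_completion C) (A, p) (Z, Id C Z))"
    if "(A, p) \<in> Obj (weak_idempotent_completion C)" for A p
  proof -
    have A: "A \<in> Obj C" "p \<in> Mor C A A" using that by auto
    have u: "\<And>f. f \<in> Mor C Z A \<Longrightarrow> f = zero_mor C Z A" "\<And>f. f \<in> Mor C A Z \<Longrightarrow> f = zero_mor C A Z"
      using assms A(1) zero_closed[OF Z A(1)] zero_closed[OF A(1) Z] unfolding zero_object_def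
      by blast+
    have "zero_mor C Z A \<in> Mor (weak_idempotent_completion C) (Z, Id C Z) (A, p)"
      using comp_zero[OF Z A(1) A(1,2)] id_right[OF Z A(1)] zero_closed[OF Z A(1)] by simp
    moreover have "zero_mor C A Z \<in> Mor (weak_idempotent_completion C) (A, p) (Z, Id C Z)"
      using zero_comp[OF A(1) A(1) Z A(2)] id_left[OF A(1) Z] zero_closed[OF A(1) Z] by simp
    moreover have "Mor (weak_idempotent_completion C) (Z, Id C Z) (A, p) \<subseteq> Mor C Z A"
      "Mor (weak_idempotent_completion C) (A, p) (Z, Id C Z) \<subseteq> Mor C A Z"
      by auto
    ultimately show ?thesis using u by (intro conjI ex1I) (assumption, blast)+
  qed
  then show ?thesis
    unfolding zero_object_def using Id_mem_weak[OF Z] by fast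
qed

text \<open>The sum is taken as \<open>(S, Id C S)\<close> and not as the sum of the underlying
  objects with the sum of the idempotents, so that its idempotent splits trivially. The structure
  maps are those of \<open>S\<close> composed with the isomorphisms \<open>a\<close>,
  \<open>c\<close> between \<open>(A, p)\<close> and \<open>(X, Id C X)\<close>, and with
  \<open>a'\<close>, \<open>c'\<close>.\<close>

lemma biproduct_weak:
  assumes "(A, p) \<in> Obj (karoubi C)" "(A', p') \<in> Obj (karoubi C)"
    and X: "X \<in> Obj C" "a \<in> Mor C A X" "c \<in> Mor C X A" "p = c \<cdot> a" "a \<cdot> c = Id C X"
    and X': "X' \<in> Obj C" "a' \<in> Mor C A' X'" "c' \<in> Mor C X' A'" "p' = c' \<cdot> a'" "a' \<cdot> c' = Id C X'"
    and S: "biproduct C X X' S i i' \<pi> \<pi>'"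
  shows "biproduct (weak_idempotent_completion C) (A, p) (A', p') (S, Id C S)
    (i \<cdot> a) (i' \<cdot> a') (c \<cdot> \<pi>) (c' \<cdot> \<pi>')"
proof -
  have o: "A \<in> Obj C" "A' \<in> Obj C" "S \<in> Obj C" using assms S unfolding biproduct_def by auto
  have i: "i \<in> Mor C X S" "i' \<in> Mor C X' S" "\<pi> \<in> Mor C S X" "\<pi>' \<in> Mor C S X'"
    and b: "\<pi> \<cdot> i = Id C X" "\<pi>' \<cdot> i' = Id C X'" "\<pi> \<cdot> i' = zero_mor C X' X" "\<pi>' \<cdot> i = zero_mor C X X'"
      "(i \<cdot> \<pi>) \<otimes>\<^bsub>Hom C S S\<^esub> (i' \<cdot> \<pi>') = Id C S"
    using S unfolding biproduct_def by auto
  \<comment> \<open>Rebracketing brings the two inner maps together, where they are either a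
    retraction pair or two biproduct maps with known composite.\<close>
  have four: "(h \<cdot> g) \<cdot> (f \<cdot> e) = h \<cdot> ((g \<cdot> f) \<cdot> e)"
    if "P \<in> Obj C" "Q \<in> Obj C" "R \<in> Obj C" "T \<in> Obj C" "U \<in> Obj C"
      "e \<in> Mor C P Q" "f \<in> Mor C Q R" "g \<in> Mor C R T" "h \<in> Mor C T U" for P Q R T U e f g h
    using comp_assoc[OF that(1,2,3,5) that(6,7) comp_closed[OF that(3-5,8,9)]]
      comp_assoc[OF that(2-5,7-9)] comp_assoc[OF that(1,2,4,5,6) comp_closed[OF that(2-4,7,8)] that(9)]
    by simp
  have cl: "i \<cdot> a \<in> Mor C A S" "i' \<cdot> a' \<in> Mor C A' S" "c \<cdot> \<pi> \<in> Mor C S A" "c' \<cdot> \<pi>' \<in> Mor C S A'"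
    using comp_closed o X X' i by blast+
  have ap: "a \<cdot> p = a" "p \<cdot> c = c" "a' \<cdot> p' = a'" "p' \<cdot> c' = c'"
    using X X' o comp_assoc[of A X A X a c a] comp_assoc[of X A X A c a c]
      comp_assoc[of A' X' A' X' a' c' a'] comp_assoc[of X' A' X' A' c' a' c'] id_left id_right
    by auto
  have split_eqs: "(c \<cdot> \<pi>) \<cdot> (i \<cdot> a) = p" "(c' \<cdot> \<pi>') \<cdot> (i' \<cdot> a') = p'"
    "(c \<cdot> \<pi>) \<cdot> (i' \<cdot> a') = zero_mor C A' A" "(c' \<cdot> \<pi>') \<cdot> (i \<cdot> a) = zero_mor C A A'"
    "(i \<cdot> a) \<cdot> (c \<cdot> \<pi>) = i \<cdot> \<pi>" "(i' \<cdot> a') \<cdot> (c' \<cdot> \<pi>') = i' \<cdot> \<pi>'"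
    using four[of A X S X A a i \<pi> c] four[of A' X' S X' A' a' i' \<pi>' c']
      four[of A' X' S X A a' i' \<pi> c] four[of A X S X' A' a i \<pi>' c']
      four[of S X A X S \<pi> c a i] four[of S X' A' X' S \<pi>' c' a' i'] b o X X' i id_left
      zero_comp[of A' X' X a'] zero_comp[of A X X' a] comp_zero[of A' X A c] comp_zero[of A X' A' c']
    by auto
  have abs: "(i \<cdot> a) \<cdot> p = i \<cdot> a" "(i' \<cdot> a') \<cdot> p' = i' \<cdot> a'"
    "p \<cdot> (c \<cdot> \<pi>) = c \<cdot> \<pi>" "p' \<cdot> (c' \<cdot> \<pi>') = c' \<cdot> \<pi>'"
    using comp_assoc[of A A X S p a i] comp_assoc[of A' A' X' S p' a' i']
      comp_assoc[of S X A A \<pi> c p] comp_assoc[of S X' A' A' \<pi>' c' p'] ap o X(1-3) X'(1-3) i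
      assms(1,2)
    by simp_all
  have "splits C A p" "splits C A' p'" unfolding splits_def using X X' by blast+
  then show ?thesis
    unfolding biproduct_def
    using assms(1,2) Id_mem_weak[OF o(3)] cl split_eqs abs b id_left id_right o by simp
qed

lemma additive_category_weak: "additive_category (weak_idempotent_completion C)"
proof -
  have "preadditive_category (weak_idempotent_completion C)"
    unfolding weak_idempotent_completion_def
    by (rule preadditive_category_subset[OF preadditive_category_karoubi]) auto
  moreover have "\<exists>Z. zero_object (weak_idempotent_completion C) Z"
    using zero_object_exists zero_object_weak by blast
  moreover have "\<exists>S i i' \<pi> \<pi>'. biproduct (weak_idempotent_completion C) A A' S i i' \<pi> \<pi>'"
    if "A \<in> Obj (weak_idempotent_completion C)" "A' \<in> Obj (weak_idempotent_completion C)" for A A'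
  proof -
    obtain B p B' p' where A: "A = (B, p)" "A' = (B', p')" by (cases A; cases A')
    then have k: "(B, p) \<in> Obj (karoubi C)" "(B', p') \<in> Obj (karoubi C)"
      and s: "splits C B p" "splits C B' p'"
      using that by auto
    obtain X a c X' a' c'
      where X: "X \<in> Obj C" "a \<in> Mor C B X" "c \<in> Mor C X B" "p = c \<cdot> a" "a \<cdot> c = Id C X"
        and X': "X' \<in> Obj C" "a' \<in> Mor C B' X'" "c' \<in> Mor C X' B'" "p' = c' \<cdot> a'" "a' \<cdot> c' = Id C X'"
      using s unfolding splits_def by blast
    obtain S i i' \<pi> \<pi>' where "biproduct C X X' S i i' \<pi> \<pi>'" using biproduct_exists X X' by blast
    from biproduct_weak[OF k X X' this] show ?thesis unfolding A by blast
  qed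
  ultimately show ?thesis
    by (simp add: additive_category_def additive_category_axioms_def)
qed

end


section \<open>Extensions in the idempotent completion\<close>

lemma (in category) mem_seq_class_self:
  assumes "s \<in> sequences C A D" "A \<in> Obj C" "D \<in> Obj C"
  shows "s \<in> seq_class C A D s"
proof -
  obtain x B y where s: "s = (x, B, y)" by (cases s)
  have "isomorphism C B B (Id C B)" "Id C B \<cdot> x = x" "y \<cdot> Id C B = y" "B \<in> Obj C"
    using assms s id_closed id_left id_right unfolding isomorphism_def sequences_def by auto
  then show ?thesis using assms s by (auto simp: seq_class_def seq_equiv_def)
qed

lemma (in additive_realisation) Real_subset_sequences:
  assumes "D \<in> Obj C" "A \<in> Obj C" "\<delta> \<in> carrier (Ext C D A)" "(x, B, y) \<in> Real C D A \<delta>"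
  shows "B \<in> Obj C" "x \<in> Mor C A B" "y \<in> Mor C B D"
  using real_class[OF assms(1-3)] assms(4)
  by (auto simp: quotient_def seq_equiv_def sequences_def)

lemma (in additive_realisation) Real_nonempty:
  assumes "D \<in> Obj C" "A \<in> Obj C" "\<delta> \<in> carrier (Ext C D A)"
  obtains x B y where "(x, B, y) \<in> Real C D A \<delta>"
proof -
  obtain s where "s \<in> sequences C A D" "Real C D A \<delta> = seq_class C A D s"
    using real_class[OF assms] by (auto simp: quotient_def seq_class_def)
  then show ?thesis using mem_seq_class_self assms that by (metis prod_cases3)
qed

section \<open>Weak cokernels, square-zero corrections and the splitting of the middle
  idempotent\<close>

context extriangulated_category
begin

text \<open>A map \<open>n\<close> vanishing on the inflation gives a commuting square from the
  realisation of \<delta> to the sequence 0 \<rightarrow> W \<rightarrow> W realising the zero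
  extension; (ET3) completes it, and the third map is the required factor.\<close>

lemma deflation_weak_cokernel:
  assumes o: "D \<in> Obj C" "A \<in> Obj C" "\<delta> \<in> carrier (Ext C D A)" "(x, B, y) \<in> Real C D A \<delta>"
    and W: "W \<in> Obj C" "n \<in> Mor C B W" "n \<cdot> x = zero_mor C A W"
  obtains k where "k \<in> Mor C D W" "k \<cdot> y = n"
proof -
  note s = Real_subset_sequences[OF o]
  obtain Z where Z: "zero_object C Z" using zero_object_exists by blast
  then have ZO: "Z \<in> Obj C" unfolding zero_object_def by blast
  have bp: "biproduct C Z W W (zero_mor C Z W) (Id C W) (zero_mor C W Z) (Id C W)"
    by (rule biproduct_zero_left[OF preadditive_category_axioms Z W(1)])
  have "(zero_mor C Z W, W, Id C W) \<in> sequences C Z W"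
    using W ZO zero_closed id_closed by (auto simp: sequences_def)
  then have r: "(zero_mor C Z W, W, Id C W) \<in> Real C W Z \<one>\<^bsub>Ext C W Z\<^esub>"
    using real_zero[OF bp] mem_seq_class_self ZO W by simp
  have one: "\<one>\<^bsub>Ext C W Z\<^esub> \<in> carrier (Ext C W Z)"
    using ext_comm_group[OF W(1) ZO] by (meson comm_group.axioms(2) group.subgroup_self subgroup.one_closed)
  \<comment> \<open>The left square required by (ET3): both ways round are zero.\<close>
  have "n \<cdot> x = zero_mor C Z W \<cdot> zero_mor C A Z"
    using W(3) zero_comp[OF o(2) ZO W(1) zero_closed[OF o(2) ZO]] by simp
  from ET3[OF o(2,1) ZO W(1) o(3) one o(4) r zero_closed[OF o(2) ZO] W(2) this]
  obtain k where "k \<in> Mor C D W" "k \<cdot> y = Id C W \<cdot> n" by blast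
  then show ?thesis using that id_left s W by simp
qed

text \<open>With \<open>\<nu>\<close> the difference \<open>e - \<phi>\<close>, which squares to zero, the inverse is \<open>e + \<nu>\<close>.\<close>

lemma invertible_relative_to_idempotent:
  assumes o: "D \<in> Obj C" "A \<in> Obj C" "\<delta> \<in> carrier (Ext C D A)" "(x, B, y) \<in> Real C D A \<delta>"
    and e: "e \<in> Mor C B B" "e \<cdot> e = e"
    and \<phi>: "\<phi> \<in> Mor C B B" "e \<cdot> \<phi> = \<phi>" "\<phi> \<cdot> e = \<phi>" "\<phi> \<cdot> x = e \<cdot> x" "y \<cdot> \<phi> = y \<cdot> e"
  obtains \<psi> where "\<psi> \<in> Mor C B B" "e \<cdot> \<psi> = \<psi>" "\<psi> \<cdot> e = \<psi>" "\<psi> \<cdot> \<phi> = e" "\<phi> \<cdot> \<psi> = e"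
proof -
  note s = Real_subset_sequences[OF o]
  note B = s(1)
  interpret G: comm_group "Hom C B B" using hom_comm_group B by blast
  define \<nu> where "\<nu> = (inv\<^bsub>Hom C B B\<^esub> \<phi>) \<otimes>\<^bsub>Hom C B B\<^esub> e"
  have n: "\<nu> \<in> Mor C B B" using \<phi> e unfolding \<nu>_def by simp
  have sum: "\<phi> \<otimes>\<^bsub>Hom C B B\<^esub> \<nu> = e"
    using \<phi> e unfolding \<nu>_def by (simp add: G.m_assoc[symmetric])
  \<comment> \<open>Composing the sum \<open>\<phi> + \<nu> = e\<close> with \<open>e\<close> on the
    left fixes \<open>\<phi>\<close> and \<open>e\<close>, so \<open>\<phi>\<close> can be
    cancelled; the other side is symmetric.\<close>
  have en: "e \<cdot> \<nu> = \<nu>"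
  proof -
    have "\<phi> \<otimes>\<^bsub>Hom C B B\<^esub> (e \<cdot> \<nu>) = \<phi> \<otimes>\<^bsub>Hom C B B\<^esub> \<nu>"
      using comp_add_right[OF B B B \<phi>(1) n e(1)] sum e \<phi> by simp
    then show ?thesis using G.Units_l_cancel G.Units_eq \<phi> n comp_closed[OF B B B n e(1)] by blast
  qed
  have ne: "\<nu> \<cdot> e = \<nu>"
  proof -
    have "\<phi> \<otimes>\<^bsub>Hom C B B\<^esub> (\<nu> \<cdot> e) = \<phi> \<otimes>\<^bsub>Hom C B B\<^esub> \<nu>"
      using comp_add_left[OF B B B e(1) \<phi>(1) n] sum e \<phi> by simp
    then show ?thesis using G.Units_l_cancel G.Units_eq \<phi> n comp_closed[OF B B B e(1) n] by blast
  qed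
  \<comment> \<open>Since \<open>\<phi>\<close> and \<open>e = \<phi> + \<nu>\<close> agree after
    \<open>x\<close>, cancellation leaves zero. So \<open>\<nu>\<close> factors as
    \<open>k \<cdot> y\<close>; as \<open>y \<cdot> \<nu>\<close> is zero for the dual reason, the
    square of \<open>\<nu>\<close> is \<open>k \<cdot> (y \<cdot> \<nu>) = 0\<close>.\<close>
  have "\<nu> \<cdot> x = zero_mor C A B"
    using comp_add_left[OF o(2) B B s(2) \<phi>(1) n] sum \<phi>(4)
      add_eq_self[OF o(2) B comp_closed[OF o(2) B B s(2) \<phi>(1)] comp_closed[OF o(2) B B s(2) n]]
    by simp
  then obtain k where k: "k \<in> Mor C D B" "k \<cdot> y = \<nu>"
    using deflation_weak_cokernel[OF o B n] by blast
  have "y \<cdot> \<nu> = zero_mor C B D"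
    using comp_add_right[OF B B o(1) \<phi>(1) n s(3)] sum \<phi>(5)
      add_eq_self[OF B o(1) comp_closed[OF B B o(1) \<phi>(1) s(3)] comp_closed[OF B B o(1) n s(3)]]
    by simp
  then have nn: "\<nu> \<cdot> \<nu> = zero_mor C B B"
    using comp_assoc[OF B B o(1) B n s(3) k(1)] k comp_zero[OF B o(1) B k(1)] by simp
  \<comment> \<open>Expand \<open>\<nu> = \<nu> \<cdot> e = \<nu> \<cdot> (\<phi> + \<nu>)\<close>
    and drop the square of \<open>\<nu>\<close>; likewise on the left. Then \<open>e + \<nu>\<close>
    times \<open>\<phi>\<close>, in either order, is \<open>\<phi> + \<nu> = e\<close>.\<close>
  have n\<phi>: "\<nu> \<cdot> \<phi> = \<nu>" "\<phi> \<cdot> \<nu> = \<nu>"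
    using comp_add_right[OF B B B \<phi>(1) n n] comp_add_left[OF B B B n \<phi>(1) n] sum nn ne en
      comp_closed[OF B B B n \<phi>(1)] comp_closed[OF B B B \<phi>(1) n]
    by simp_all
  show ?thesis
  proof (rule that[of "e \<otimes>\<^bsub>Hom C B B\<^esub> \<nu>"])
    show "e \<otimes>\<^bsub>Hom C B B\<^esub> \<nu> \<in> Mor C B B" using e n by simp
    show "e \<cdot> (e \<otimes>\<^bsub>Hom C B B\<^esub> \<nu>) = e \<otimes>\<^bsub>Hom C B B\<^esub> \<nu>"
      using comp_add_right[OF B B B e(1) n e(1)] e en by simp
    show "(e \<otimes>\<^bsub>Hom C B B\<^esub> \<nu>) \<cdot> e = e \<otimes>\<^bsub>Hom C B B\<^esub> \<nu>"
      using comp_add_left[OF B B B e(1) e(1) n] e ne by simp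
    show "(e \<otimes>\<^bsub>Hom C B B\<^esub> \<nu>) \<cdot> \<phi> = e"
      using comp_add_left[OF B B B \<phi>(1) e(1) n] \<phi> n\<phi> sum by simp
    show "\<phi> \<cdot> (e \<otimes>\<^bsub>Hom C B B\<^esub> \<nu>) = e"
      using comp_add_right[OF B B B e(1) n \<phi>(1)] \<phi> n\<phi> sum by simp
  qed
qed

text \<open>By functoriality \<open>ExtMap C p q\<close> is idempotent and absorbs each of its
  one-variable parts, so everything in its image is fixed by all three maps.\<close>

lemma ext_idempotent_fixed:
  assumes o: "X \<in> Obj C" "Z \<in> Obj C" "p \<in> Mor C Z Z" "p \<cdot> p = p" "q \<in> Mor C X X" "q \<cdot> q = q"
    and \<delta>0: "\<delta>0 \<in> carrier (Ext C Z X)" "\<delta> = pull C X p (push C Z q \<delta>0)"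
  shows "\<delta> \<in> carrier (Ext C Z X)" "ExtMap C p q \<delta> = \<delta>"
    "ExtMap C p (Id C X) \<delta> = \<delta>" "ExtMap C (Id C Z) q \<delta> = \<delta>"
proof -
  note i = id_closed[OF o(1)] id_closed[OF o(2)]
  have \<delta>: "\<delta> = ExtMap C p q \<delta>0"
    using ext_map_comp[OF o(2,2,2) o(1,1,1) i(2) o(3) o(5) i(1) \<delta>0(1)] \<delta>0(2) id_left o
    unfolding pull_def push_def by simp
  show "\<delta> \<in> carrier (Ext C Z X)"
    using ext_map_hom[OF o(2,2,1,1,3,5)] \<delta>0(1) unfolding \<delta> hom_def by blast
  show "ExtMap C p q \<delta> = \<delta>" "ExtMap C p (Id C X) \<delta> = \<delta>" "ExtMap C (Id C Z) q \<delta> = \<delta>"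
    using ext_map_comp[OF o(2,2,2) o(1,1,1) o(3) o(3) o(5) o(5) \<delta>0(1)]
      ext_map_comp[OF o(2,2,2) o(1,1,1) o(3) o(3) o(5) i(1) \<delta>0(1)]
      ext_map_comp[OF o(2,2,2) o(1,1,1) o(3) i(2) o(5) o(5) \<delta>0(1)] id_left id_right o
    unfolding \<delta> by simp_all
qed

text \<open>Invariance of \<delta> under \<open>q\<close> makes the inclusions \<open>(c, d)\<close>
  a morphism of extensions, and invariance under \<open>p\<close> does the same for the retractions
  \<open>(a, b)\<close>. The splitting is through the middle term \<open>E\<close> of the compressed
  extension.\<close>

lemma middle_idempotent_splits:
  assumes o: "X \<in> Obj C" "Z \<in> Obj C" "p \<in> Mor C Z Z" "p \<cdot> p = p" "q \<in> Mor C X X" "q \<cdot> q = q"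
    and \<delta>: "\<delta> \<in> carrier (Ext C Z X)"
      "ExtMap C p (Id C X) \<delta> = \<delta>" "ExtMap C (Id C Z) q \<delta> = \<delta>"
    and real: "(x, Y, y) \<in> Real C Z X \<delta>"
    and r: "r \<in> Mor C Y Y" "r \<cdot> r = r" "r \<cdot> x = x \<cdot> q" "y \<cdot> r = p \<cdot> y"
    and sp: "splits C Z p" "splits C X q"
  shows "splits C Y r"
proof -
  obtain X' a c where X': "X' \<in> Obj C" "a \<in> Mor C X X'" "c \<in> Mor C X' X" "q = c \<cdot> a" "a \<cdot> c = Id C X'"
    using sp unfolding splits_def by blast
  obtain Z' b d where Z': "Z' \<in> Obj C" "b \<in> Mor C Z Z'" "d \<in> Mor C Z' Z" "p = d \<cdot> b" "b \<cdot> d = Id C Z'"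
    using sp unfolding splits_def by blast
  note s = Real_subset_sequences[OF o(2,1) \<delta>(1) real]
  note idc = id_closed[OF o(1)] id_closed[OF o(2)] id_closed[OF X'(1)] id_closed[OF Z'(1)]
  define \<epsilon> where "\<epsilon> = ExtMap C d a \<delta>"
  have \<epsilon>: "\<epsilon> \<in> carrier (Ext C Z' X')"
    using ext_map_hom[OF o(2) Z'(1) o(1) X'(1) Z'(3) X'(2)] \<delta>(1) unfolding \<epsilon>_def hom_def by blast
  obtain u E v where E: "(u, E, v) \<in> Real C Z' X' \<epsilon>"
    using Real_nonempty[OF Z'(1) X'(1) \<epsilon>] by blast
  note t = Real_subset_sequences[OF Z'(1) X'(1) \<epsilon> E]
  \<comment> \<open>Pushing along \<open>c\<close> after \<open>a\<close> is pushing along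
    \<open>q\<close>, which fixes \<delta>; only the pullback along \<open>d\<close>
    remains.\<close>
  have "push C Z' c \<epsilon> = ExtMap C d q \<delta>"
    using ext_map_comp[OF o(2) Z'(1) Z'(1) o(1) X'(1) o(1) Z'(3) idc(4) X'(2,3) \<delta>(1)] X' Z' o id_right
    unfolding push_def \<epsilon>_def by simp
  also have "\<dots> = pull C X d \<delta>"
    using ext_map_comp[OF o(2) o(2) Z'(1) o(1) o(1) o(1) idc(2) Z'(3) o(5) idc(1) \<delta>(1)] \<delta>(3)
      Z' o id_left
    unfolding pull_def by simp
  finally have "push C Z' c \<epsilon> = pull C X d \<delta>" .
  from real_morphism[OF X'(1) Z'(1) o(1,2) \<epsilon> \<delta>(1) E real X'(3) Z'(3) this]
  obtain f where f: "f \<in> Mor C E Y" "f \<cdot> u = x \<cdot> c" "y \<cdot> f = d \<cdot> v" by blast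
  \<comment> \<open>Dually, pulling back along \<open>d\<close> and then \<open>b\<close> is pulling
    back along \<open>p\<close>, which fixes \<delta>; only the pushforward along \<open>a\<close>
    remains.\<close>
  have "pull C X' b \<epsilon> = ExtMap C p a \<delta>"
    using ext_map_comp[OF o(2) Z'(1) o(2) o(1) X'(1) X'(1) Z'(3) Z'(2) X'(2) idc(3) \<delta>(1)] X' Z' o id_left
    unfolding pull_def \<epsilon>_def by simp
  also have "\<dots> = push C Z a \<delta>"
    using ext_map_comp[OF o(2) o(2) o(2) o(1) o(1) X'(1) o(3) idc(2) idc(1) X'(2) \<delta>(1)] \<delta>(2)
      X' o id_right
    unfolding push_def by simp
  finally have "push C Z a \<delta> = pull C X' b \<epsilon>" by simp
  from real_morphism[OF o(1,2) X'(1) Z'(1) \<delta>(1) \<epsilon> real E X'(2) Z'(2) this]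
  obtain g where g: "g \<in> Mor C Y E" "g \<cdot> x = u \<cdot> a" "v \<cdot> g = b \<cdot> y" by blast
  \<comment> \<open>The lifts \<open>f\<close> and \<open>g\<close> need not respect
    \<open>r\<close>. Composing with \<open>r\<close> turns them into morphisms of the Karoubi
    envelope between \<open>(E, Id C E)\<close> and \<open>(Y, r)\<close>.\<close>
  define \<alpha> where "\<alpha> = r \<cdot> f"
  define \<beta> where "\<beta> = g \<cdot> r"
  have m: "\<alpha> \<in> Mor C E Y" "\<beta> \<in> Mor C Y E"
    using comp_closed f g r s t unfolding \<alpha>_def \<beta>_def by blast+
  have qc: "q \<cdot> c = c" "a \<cdot> q = a" and pd: "p \<cdot> d = d" "b \<cdot> p = b"
    using comp_assoc[OF X'(1) o(1) X'(1) o(1) X'(3) X'(2) X'(3)]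
      comp_assoc[OF o(1) X'(1) o(1) X'(1) X'(2) X'(3) X'(2)]
      comp_assoc[OF Z'(1) o(2) Z'(1) o(2) Z'(3) Z'(2) Z'(3)]
      comp_assoc[OF o(2) Z'(1) o(2) Z'(1) Z'(2) Z'(3) Z'(2)] X' Z' o id_left id_right
    by simp_all
  have \<alpha>r: "r \<cdot> \<alpha> = \<alpha>" and \<beta>r: "\<beta> \<cdot> r = \<beta>"
    using comp_assoc[OF t(1) s(1) s(1) s(1) f(1) r(1) r(1)]
      comp_assoc[OF s(1) s(1) s(1) t(1) r(1) r(1) g(1)] r unfolding \<alpha>_def \<beta>_def by simp_all
  \<comment> \<open>The correction keeps all four squares: \<open>r\<close> passes \<open>x\<close>
    as \<open>q\<close> and \<open>y\<close> as \<open>p\<close>, and these are absorbed by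
    \<open>c\<close>, \<open>a\<close>, \<open>d\<close> and \<open>b\<close>.\<close>
  have \<alpha>u: "\<alpha> \<cdot> u = x \<cdot> c"
    using comp_assoc[OF X'(1) t(1) s(1) s(1) t(2) f(1) r(1)] f(2) r(3) qc
      comp_assoc[OF X'(1) o(1) s(1) s(1) X'(3) s(2) r(1)]
      comp_assoc[OF X'(1) o(1) o(1) s(1) X'(3) o(5) s(2)]
    unfolding \<alpha>_def by simp
  have y\<alpha>: "y \<cdot> \<alpha> = d \<cdot> v"
    using comp_assoc[OF t(1) s(1) s(1) o(2) f(1) r(1) s(3)] f(3) r(4) pd
      comp_assoc[OF t(1) s(1) o(2) o(2) f(1) s(3) o(3)]
      comp_assoc[OF t(1) Z'(1) o(2) o(2) t(3) Z'(3) o(3)]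
    unfolding \<alpha>_def by simp
  have \<beta>x: "\<beta> \<cdot> x = u \<cdot> a"
    using comp_assoc[OF o(1) s(1) s(1) t(1) s(2) r(1) g(1)] g(2) r(3) qc
      comp_assoc[OF o(1) o(1) s(1) t(1) o(5) s(2) g(1)]
      comp_assoc[OF o(1) o(1) X'(1) t(1) o(5) X'(2) t(2)]
    unfolding \<beta>_def by simp
  have v\<beta>: "v \<cdot> \<beta> = b \<cdot> y"
    using comp_assoc[OF s(1) s(1) t(1) Z'(1) r(1) g(1) t(3)] g(3) r(4) pd
      comp_assoc[OF s(1) s(1) o(2) Z'(1) r(1) s(3) Z'(2)]
      comp_assoc[OF s(1) o(2) o(2) Z'(1) s(3) o(3) Z'(2)]
    unfolding \<beta>_def by simp
  have cl: "\<beta> \<cdot> \<alpha> \<in> Mor C E E" "\<alpha> \<cdot> \<beta> \<in> Mor C Y Y" using comp_closed m s t by blast+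
  have \<beta>\<alpha>u: "(\<beta> \<cdot> \<alpha>) \<cdot> u = Id C E \<cdot> u"
    using comp_assoc[OF X'(1) t(1) s(1) t(1) t(2) m(1) m(2)]
      comp_assoc[OF X'(1) o(1) s(1) t(1) X'(3) s(2) m(2)]
      comp_assoc[OF X'(1) o(1) X'(1) t(1) X'(3) X'(2) t(2)] \<alpha>u \<beta>x X' id_left id_right t
    by simp
  have v\<beta>\<alpha>: "v \<cdot> (\<beta> \<cdot> \<alpha>) = v \<cdot> Id C E"
    using comp_assoc[OF t(1) s(1) t(1) Z'(1) m(1) m(2) t(3)]
      comp_assoc[OF t(1) s(1) o(2) Z'(1) m(1) s(3) Z'(2)]
      comp_assoc[OF t(1) Z'(1) o(2) Z'(1) t(3) Z'(3) Z'(2)] y\<alpha> v\<beta> Z' id_left id_right t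
    by simp
  \<comment> \<open>The case \<open>e = Id C E\<close>: here \<open>\<beta> \<cdot> \<alpha>\<close>
    agrees with the identity after \<open>u\<close> and before \<open>v\<close>, because
    \<open>a \<cdot> c\<close> and \<open>b \<cdot> d\<close> are identities.\<close>
  obtain \<psi> where \<psi>: "\<psi> \<in> Mor C E E" "\<psi> \<cdot> (\<beta> \<cdot> \<alpha>) = Id C E"
    using invertible_relative_to_idempotent[OF Z'(1) X'(1) \<epsilon> E id_closed[OF t(1)] _ cl(1) _ _ \<beta>\<alpha>u v\<beta>\<alpha>]
      id_left[OF t(1) t(1)] id_right[OF t(1) t(1)] cl(1) id_closed[OF t(1)] by metis
  \<comment> \<open>On the other side \<open>c \<cdot> a = q\<close> and
    \<open>d \<cdot> b = p\<close> appear, and \<open>x \<cdot> q = r \<cdot> x\<close>,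
    \<open>p \<cdot> y = y \<cdot> r\<close> turn them into \<open>r\<close>. So the comparison for
    \<open>\<alpha> \<cdot> \<beta>\<close> is with \<open>e = r\<close>.\<close>
  have \<alpha>\<beta>x: "(\<alpha> \<cdot> \<beta>) \<cdot> x = r \<cdot> x"
    using comp_assoc[OF o(1) s(1) t(1) s(1) s(2) m(2) m(1)]
      comp_assoc[OF o(1) X'(1) t(1) s(1) X'(2) t(2) m(1)]
      comp_assoc[OF o(1) X'(1) o(1) s(1) X'(2) X'(3) s(2)] \<alpha>u \<beta>x X' r
    by simp
  have y\<alpha>\<beta>: "y \<cdot> (\<alpha> \<cdot> \<beta>) = y \<cdot> r"
    using comp_assoc[OF s(1) t(1) s(1) o(2) m(2) m(1) s(3)]
      comp_assoc[OF s(1) t(1) Z'(1) o(2) m(2) t(3) Z'(3)]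
      comp_assoc[OF s(1) o(2) Z'(1) o(2) s(3) Z'(2) Z'(3)] y\<alpha> v\<beta> Z' r
    by simp
  have "r \<cdot> (\<alpha> \<cdot> \<beta>) = \<alpha> \<cdot> \<beta>" "(\<alpha> \<cdot> \<beta>) \<cdot> r = \<alpha> \<cdot> \<beta>"
    using comp_assoc[OF s(1) t(1) s(1) s(1) m(2) m(1) r(1)]
      comp_assoc[OF s(1) s(1) t(1) s(1) r(1) m(2) m(1)] \<alpha>r \<beta>r by simp_all
  then obtain \<chi> where \<chi>: "\<chi> \<in> Mor C Y Y" "(\<alpha> \<cdot> \<beta>) \<cdot> \<chi> = r"
    using invertible_relative_to_idempotent[OF o(2,1) \<delta>(1) real r(1,2) cl(2) _ _ \<alpha>\<beta>x y\<alpha>\<beta>] by blast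
  \<comment> \<open>So far \<open>\<alpha>\<close> has the right inverse
    \<open>\<beta> \<cdot> \<chi>\<close> relative to \<open>r\<close> and the left inverse
    \<open>\<psi> \<cdot> \<beta>\<close>. The usual argument identifies the two, and the resulting
    \<open>\<gamma>\<close> is the retraction of the splitting
    \<open>r = \<alpha> \<cdot> \<gamma>\<close>.\<close>
  define \<gamma> where "\<gamma> = \<beta> \<cdot> \<chi>"
  have \<gamma>: "\<gamma> \<in> Mor C Y E" using comp_closed[OF s(1) s(1) t(1) \<chi>(1) m(2)] unfolding \<gamma>_def .
  have \<alpha>\<gamma>: "\<alpha> \<cdot> \<gamma> = r"
    using comp_assoc[OF s(1) s(1) t(1) s(1) \<chi>(1) m(2) m(1)] \<chi> unfolding \<gamma>_def by simp
  have "\<gamma> = (\<psi> \<cdot> (\<beta> \<cdot> \<alpha>)) \<cdot> \<gamma>" using \<psi> id_left[OF s(1) t(1) \<gamma>] by simp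
  also have "\<dots> = \<psi> \<cdot> (\<beta> \<cdot> (\<alpha> \<cdot> \<gamma>))"
    using comp_assoc[OF s(1) t(1) t(1) t(1) \<gamma> cl(1) \<psi>(1)]
      comp_assoc[OF s(1) t(1) s(1) t(1) \<gamma> m(1) m(2)] by simp
  finally have "\<gamma> = \<psi> \<cdot> \<beta>" using \<alpha>\<gamma> \<beta>r by simp
  then have "\<gamma> \<cdot> \<alpha> = Id C E"
    using comp_assoc[OF t(1) s(1) t(1) t(1) m(1) m(2) \<psi>(1)] \<psi> by simp
  then show ?thesis unfolding splits_def using \<alpha>\<gamma> \<gamma> m t(1) by metis
qed

end

section \<open>Passage to conflations of the idempotent completion\<close>

lemma idempotent_completion_simps [simp]:
  "Obj (idempotent_completion C) = Obj (karoubi C)"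
  "Hom (idempotent_completion C) = Hom (karoubi C)"
  "Comp (idempotent_completion C) = Comp C"
  "Id (idempotent_completion C) = snd"
  "isomorphism (idempotent_completion C) = isomorphism (karoubi C)"
  by (auto simp: idempotent_completion_def isomorphism_def karoubi_def fun_eq_iff)

text \<open>A conflation of the completion is only equivalent to a sequence of the defining form
  with middle term \<open>(Y, r)\<close>. The splitting of \<open>r\<close> is therefore carried
  along the isomorphism contained in that equivalence.\<close>

lemma conflation_middle_splits:
  fixes C :: "('o, 'm, 'e) extri_data" (structure)
  assumes "extriangulated_category C"
    and confl: "conflation (idempotent_completion C) (X, q) x' (W, s) y' (Z, p)"
    and sp: "splits C X q" "splits C Z p"
  shows "(W, s) \<in> Obj (karoubi C) \<and> splits C W s"
proof -
  interpret extriangulated_category C by fact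
  have o: "X \<in> Obj C" "Z \<in> Obj C" "p \<in> Mor C Z Z" "p \<cdot> p = p" "q \<in> Mor C X X" "q \<cdot> q = q"
    using confl by (auto simp: conflation_def)
  obtain \<delta> where \<delta>: "\<delta> \<in> carrier (Ext (idempotent_completion C) (Z, p) (X, q))"
    and mem: "(x', (W, s), y') \<in> Real (idempotent_completion C) (Z, p) (X, q) \<delta>"
    using confl unfolding conflation_def by blast
  obtain \<delta>0 where "\<delta>0 \<in> carrier (Ext C Z X)" "\<delta> = pull C X p (push C Z q \<delta>0)"
    using \<delta> by (auto simp: idempotent_completion_def)
  note fixed = ext_idempotent_fixed[OF o this]
  \<comment> \<open>Membership in the union defining the realisation yields one concrete choice of
    representative and idempotent, which is all that is needed.\<close>
  obtain x Y y r where real: "(x, Y, y) \<in> Real C Z X \<delta>"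
    and r: "r \<in> Mor C Y Y" "r \<cdot> r = r" "r \<cdot> x = x \<cdot> q" "y \<cdot> r = p \<cdot> y"
    and cls: "(x', (W, s), y') \<in> seq_class (karoubi C) (X, q) (Z, p) (x \<cdot> q, (Y, r), p \<cdot> y)"
    using mem by (auto simp: idempotent_completion_def)
  obtain h where h: "isomorphism (karoubi C) (Y, r) (W, s) h"
    and ob: "(Y, r) \<in> Obj (karoubi C)" "(W, s) \<in> Obj (karoubi C)"
    using cls by (auto simp: seq_class_def seq_equiv_def sequences_def)
  have "splits C Y r"
    by (rule middle_idempotent_splits[OF o fixed(1,3,4) real r sp(2,1)])
  then show ?thesis using splits_of_isomorphism[OF ob h] ob(2) by blast
qed

theorem proposition3p26:
  fixes C :: "('o, 'm, 'e) extri_data"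
  assumes "extriangulated_category C"
  shows "extension_closed_subcategory (weak_idempotent_completion C) (idempotent_completion C)"
proof -
  interpret extriangulated_category C by fact
  \<comment> \<open>Both categories carry the hom-groups, composition and identities of
    \<open>karoubi C\<close>; they differ only in their sets of objects.\<close>
  have "full_subcategory (weak_idempotent_completion C) (idempotent_completion C)"
    by (auto simp: full_subcategory_def simp del: karoubi_simps)
  moreover have "B \<in> Obj (weak_idempotent_completion C)"
    if "A \<in> Obj (weak_idempotent_completion C)" "B \<in> Obj (idempotent_completion C)"
      "isomorphism (idempotent_completion C) A B f" for A B f
    using that splits_of_isomorphism by (cases A; cases B) (auto simp del: karoubi_simps)
  moreover have "B \<in> Obj (weak_idempotent_completion C)"
    if "conflation (idempotent_completion C) A x B y D"
      "A \<in> Obj (weak_idempotent_completion C)" "D \<in> Obj (weak_idempotent_completion C)" for A x B y D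
    using that conflation_middle_splits[OF assms] by (cases A; cases B; cases D) (auto simp del: karoubi_simps)
  ultimately show ?thesis
    unfolding extension_closed_subcategory_def using additive_category_weak by blast
qed

end
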